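(* Let $T$ be exponentially distributed with rate $\lambda>0$ and suppose that $v_\beta>0$. If $v^*$ is an optimal trajectory that ends in $EL\leadsto\beta$ (an Euler--Lagrange phase followed by a phase of slope $-\beta$ down to velocity $0$, after which the velocity remains $0$), then $v^*$ switches from an Euler--Lagrange curve to slope $-\beta$ upon reaching a velocity $v_c^*$ that is the unique solution of the equation $\mathcal{F}(v_c)=0$ in the range $v_\beta\le v_c<v_{\max}$, where $$\mathcal{F}(v_c):=-\frac{\lambda^2}{\beta}v_c^2+\frac{\lambda}{\beta}(\beta+\lambda A)v_c+\bigl(e^{-\lambda v_c/\beta}-1\bigr)(\beta+\lambda A).$$
   Context: Let $\alpha,\beta,v_{\max},\lambda>0$, $0\le v_0\le v_{\max}$, $d>0$, $d\ge v_0^2/(2\beta)$, and $L\ge v_{\max}^2/(2\alpha)$ be constants. $T\sim\mathrm{Exp}(\lambda)$ has density $f(t)=\lambda e^{-\lambda t}$ on $[0,\infty)$. Put $$A=v_{\max}+\frac{\alpha}{\lambda},\qquad v_\beta=v_{\max}+\frac{\alpha-\beta}{\lambda}.$$ A function $g:[0,\infty)\to\mathbb{R}$ is $(\alpha,\beta)$-Lipschitz if $-\beta(t_2-t_1)\le g(t_2)-g(t_1)\le\alpha(t_2-t_1)$ for all $0\le t_1\le t_2$. $W$ is the set of $(\alpha,\beta)$-Lipschitz functions $v:[0,\infty)\to[0,v_{\max}]$ with $v(0)=v_0$ and $\int_0^\infty v(t)\,dt\le d$. $V\subseteq W$ is the subset of those with $\int_0^\infty v(t)\,dt=d$. Put $k(x,v)=\frac{1}{2\alpha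 v_{\max}}(v_{\max}-v)^2+\frac{1}{v_{\max}}(L-x)$, and for $v\in W$ let $S(v)=\int_0^\infty[t+k(\int_0^t v(s)\,ds,\,v(t))]f(t)\,dt$. An optimal trajectory is a $v^*\in V$ minimising $S$ over $W$. The Euler--Lagrange curves are the functions $v_{EL}(t)=A-b\,e^{\lambda t}$, with $b\in\mathbb{R}$ a constant ($v_\beta$ is the velocity at which such a curve with $b>0$ has slope $-\beta$). An Euler--Lagrange (EL) phase of a trajectory is a time interval of positive length on which it coincides with an Euler--Lagrange curve. *)

theory Defs
  imports "HOL-Probability.Probability"
begin

text \<open>Velocity profiles on \<open>[0,\<infinity>)\<close> are total functions \<open>real \<Rightarrow> real\<close> whose values at negative
  times are irrelevant.\<close>

definition lipschitz_ab :: "real \<Rightarrow> real \<Rightarrow> (real \<Rightarrow> real) \<Rightarrow> bool" where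
  "lipschitz_ab \<alpha> \<beta> g \<longleftrightarrow>
     (\<forall>t1 t2. 0 \<le> t1 \<longrightarrow> t1 \<le> t2 \<longrightarrow>
        - \<beta> * (t2 - t1) \<le> g t2 - g t1 \<and> g t2 - g t1 \<le> \<alpha> * (t2 - t1))"

text \<open>Integrability is required explicitly because the Lebesgue integral of a non-integrable
  function is \<open>0\<close> by convention.\<close>

definition trajW :: "real \<Rightarrow> real \<Rightarrow> real \<Rightarrow> real \<Rightarrow> real \<Rightarrow> (real \<Rightarrow> real) set" where
  "trajW \<alpha> \<beta> vmax v0 d =
     {v. lipschitz_ab \<alpha> \<beta> v \<and> (\<forall>t\<ge>0. 0 \<le> v t \<and> v t \<le> vmax) \<and> v 0 = v0 \<and>
         set_integrable lborel {0..} v \<and> (LINT t:{0..}|lborel. v t) \<le> d}"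

definition trajV :: "real \<Rightarrow> real \<Rightarrow> real \<Rightarrow> real \<Rightarrow> real \<Rightarrow> (real \<Rightarrow> real) set" where
  "trajV \<alpha> \<beta> vmax v0 d =
     {v \<in> trajW \<alpha> \<beta> vmax v0 d. (LINT t:{0..}|lborel. v t) = d}"

definition kcost :: "real \<Rightarrow> real \<Rightarrow> real \<Rightarrow> real \<Rightarrow> real \<Rightarrow> real" where
  "kcost \<alpha> vmax L x v = 1 / (2 * \<alpha> * vmax) * (vmax - v)\<^sup>2 + 1 / vmax * (L - x)"

text \<open>The argument \<open>f\<close> is the density of the random time \<open>T\<close>. If \<open>f\<close> is an exponential density,
  the integrand is integrable for every \<open>v\<close> in \<^const>\<open>trajW\<close>.\<close>

definition Scost :: "real \<Rightarrow> real \<Rightarrow> real \<Rightarrow> (real \<Rightarrow> real) \<Rightarrow> (real \<Rightarrow> real) \<Rightarrow> real" where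
  "Scost \<alpha> vmax L f v =
     (LINT t:{0..}|lborel. (t + kcost \<alpha> vmax L (LINT s:{0..t}|lborel. v s) (v t)) * f t)"

definition optimal_trajectory ::
  "real \<Rightarrow> real \<Rightarrow> real \<Rightarrow> real \<Rightarrow> real \<Rightarrow> real \<Rightarrow> (real \<Rightarrow> real) \<Rightarrow> (real \<Rightarrow> real) \<Rightarrow> bool" where
  "optimal_trajectory \<alpha> \<beta> vmax v0 d L f v \<longleftrightarrow>
     v \<in> trajV \<alpha> \<beta> vmax v0 d \<and>
     (\<forall>w \<in> trajW \<alpha> \<beta> vmax v0 d. Scost \<alpha> vmax L f v \<le> Scost \<alpha> vmax L f w)"

definition A_const :: "real \<Rightarrow> real \<Rightarrow> real \<Rightarrow> real" where
  "A_const \<alpha> vmax lam = vmax + \<alpha> / lam"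

definition v_beta :: "real \<Rightarrow> real \<Rightarrow> real \<Rightarrow> real \<Rightarrow> real" where
  "v_beta \<alpha> \<beta> vmax lam = vmax + (\<alpha> - \<beta>) / lam"

definition EL_curve :: "real \<Rightarrow> real \<Rightarrow> real \<Rightarrow> real \<Rightarrow> real \<Rightarrow> real" where
  "EL_curve \<alpha> vmax lam b t = A_const \<alpha> vmax lam - b * exp (lam * t)"

definition EL_phase :: "real \<Rightarrow> real \<Rightarrow> real \<Rightarrow> (real \<Rightarrow> real) \<Rightarrow> real \<Rightarrow> real \<Rightarrow> bool" where
  "EL_phase \<alpha> vmax lam v t0 t1 \<longleftrightarrow>
     0 \<le> t0 \<and> t0 < t1 \<and> (\<exists>b. \<forall>t\<in>{t0..t1}. v t = EL_curve \<alpha> vmax lam b t)"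

definition beta_phase :: "real \<Rightarrow> (real \<Rightarrow> real) \<Rightarrow> real \<Rightarrow> real \<Rightarrow> bool" where
  "beta_phase \<beta> v t1 t2 \<longleftrightarrow>
     0 \<le> t1 \<and> t1 < t2 \<and> (\<forall>t\<in>{t1..t2}. v t = v t1 - \<beta> * (t - t1))"

text \<open>\<open>tc\<close> is the time of the switch from the Euler--Lagrange curve to slope \<open>-\<beta>\<close>.\<close>

definition ends_in_EL_beta ::
  "real \<Rightarrow> real \<Rightarrow> real \<Rightarrow> real \<Rightarrow> (real \<Rightarrow> real) \<Rightarrow> real \<Rightarrow> bool" where
  "ends_in_EL_beta \<alpha> \<beta> vmax lam v tc \<longleftrightarrow>
     (\<exists>t0 t2. EL_phase \<alpha> vmax lam v t0 tc \<and> beta_phase \<beta> v tc t2 \<and> (\<forall>t\<ge>t2. v t = 0))"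

definition Fcal :: "real \<Rightarrow> real \<Rightarrow> real \<Rightarrow> real \<Rightarrow> real \<Rightarrow> real" where
  "Fcal \<alpha> \<beta> vmax lam vc =
     - (lam\<^sup>2 / \<beta>) * vc\<^sup>2 + lam / \<beta> * (\<beta> + lam * A_const \<alpha> vmax lam) * vc
     + (exp (- lam * vc / \<beta>) - 1) * (\<beta> + lam * A_const \<alpha> vmax lam)"

end

theory Submission
  imports Defs "HOL-Real_Asymp.Real_Asymp"
begin

text \<open>Integration by parts turns the expected cost into the weighted quadratic cost
  \<open>\<integral> e^(-lam t) (v - A)\<^sup>2\<close>, whose first variation at a minimiser over the convex set \<open>W\<close> is
  nonnegative in every admissible direction. On an Euler--Lagrange phase the weight
  \<open>e^(-lam t) (v - A)\<close> is the constant \<open>-b\<close>, so changes of \<open>v\<close> there that restore the total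
  integral are free of cost. Moving the final line of slope \<open>-\<beta>\<close> up or down by \<open>\<epsilon>\<close> and
  compensating on the Euler--Lagrange phase changes the cost to first order by a positive multiple of
  \<open>\<epsilon> \<F>(v_c)\<close>, hence \<open>\<F>(v_c) = 0\<close>. Uniqueness holds because \<open>\<F>(0) = \<F>'(0) = 0\<close>
  and \<open>\<F>''\<close> is strictly decreasing: a second positive zero would produce two zeros of \<open>\<F>''\<close>.\<close>

section \<open>Exponentially weighted integrals\<close>

lemma lipschitz_ab_continuous_on:
  assumes "lipschitz_ab \<alpha> \<beta> v"
  shows "continuous_on {0..} v"
proof -
  have "dist (v s) (v t) \<le> max \<bar>\<alpha>\<bar> \<bar>\<beta>\<bar> * dist s t" if "s \<ge> 0" "t \<ge> 0" for s t
  proof -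
    have *: "\<bar>v y - v x\<bar> \<le> max \<bar>\<alpha>\<bar> \<bar>\<beta>\<bar> * (y - x)" if "0 \<le> x" "x \<le> y" for x y
    proof -
      have "- \<beta> * (y - x) \<le> v y - v x" "v y - v x \<le> \<alpha> * (y - x)"
        using assms that by (auto simp: lipschitz_ab_def)
      moreover have "\<beta> * (y - x) \<le> max \<bar>\<alpha>\<bar> \<bar>\<beta>\<bar> * (y - x)" "\<alpha> * (y - x) \<le> max \<bar>\<alpha>\<bar> \<bar>\<beta>\<bar> * (y - x)"
        using that by (intro mult_right_mono; simp)+
      ultimately show ?thesis by (simp add: abs_le_iff)
    qed
    show ?thesis
      using *[of s t] *[of t s] that by (cases "s \<le> t") (auto simp: dist_real_def abs_minus_commute)
  qed
  then have "(max \<bar>\<alpha>\<bar> \<bar>\<beta>\<bar>)-lipschitz_on {0..} v"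
    by (intro lipschitz_onI) auto
  then show ?thesis
    by (rule lipschitz_on_continuous_on)
qed

text \<open>Up to the factor \<open>1 / lam\<close> the two integrands are those of the moments of
  order 0 and 1 of the exponential distribution, which are finite.\<close>

lemma set_integrable_exponential:
  assumes "lam > 0"
  shows "set_integrable lborel {0..} (\<lambda>t::real. exp (- lam * t))"
    and "set_integrable lborel {0..} (\<lambda>t::real. t * exp (- lam * t))"
proof -
  have *: "integrable lborel (\<lambda>x. exponential_density lam x * x ^ i)" for i
  proof (rule integrableI_nonneg)
    show "AE x in lborel. 0 \<le> exponential_density lam x * x ^ i"
      by (auto simp: exponential_density_def assms less_imp_le)
    show "(\<integral>\<^sup>+ x. ennreal (exponential_density lam x * x ^ i) \<partial>lborel) < \<infinity>"
      by (subst nn_integral_erlang_ith_moment[OF assms]) simp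
  qed simp
  have eq: "1 / lam * (exponential_density lam x * x ^ i) = indicator {0..} x *\<^sub>R (x ^ i * exp (- lam * x))"
    for x i using assms by (auto simp: exponential_density_def indicator_def mult.commute)
  show "set_integrable lborel {0..} (\<lambda>t::real. exp (- lam * t))"
    unfolding set_integrable_def using integrable_mult_right[of "1 / lam", OF *, of 0, unfolded eq]
    by simp
  show "set_integrable lborel {0..} (\<lambda>t::real. t * exp (- lam * t))"
    unfolding set_integrable_def using integrable_mult_right[of "1 / lam", OF *, of 1, unfolded eq]
    by simp
qed

text \<open>Domination by \<open>B * exp (- lam * t)\<close>. This covers the integrands built from
  bounded continuous profiles.\<close>

lemma set_integrable_exp_weighted:
  fixes g :: "real \<Rightarrow> real"
  assumes lam: "lam > 0" and g: "continuous_on {0..} g" and B: "\<And>t. t \<ge> 0 \<Longrightarrow> \<bar>g t\<bar> \<le> B"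
  shows "set_integrable lborel {0..} (\<lambda>t. exp (- lam * t) * g t)"
proof (rule set_integrable_bound[where f = "\<lambda>t. B * exp (- lam * t)"])
  show "set_integrable lborel {0..} (\<lambda>t. B * exp (- lam * t))"
    by (rule set_integrable_mult_right) (rule set_integrable_exponential(1)[OF lam])
  show "set_borel_measurable lborel {0..} (\<lambda>t. exp (- lam * t) * g t)"
    unfolding set_borel_measurable_def using borel_measurable_continuous_on_indicator[of "{0..}" "\<lambda>t. exp (- lam * t) * g t"]
    by (simp add: g continuous_intros)
  have "B \<ge> 0" using B[of 0] by simp
  then show "AE t in lborel. t \<in> {0..} \<longrightarrow> norm (exp (- lam * t) * g t) \<le> norm (B * exp (- lam * t))"
    using B by (auto simp: abs_mult mult.commute)
qed

lemma primitive_eq_integral: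
  fixes v :: "real \<Rightarrow> real"
  assumes "continuous_on {0..} v"
  shows "(LINT s:{0..t}|lborel. v s) = integral {0..t} v"
  by (rule set_borel_integral_eq_integral(2), rule borel_integrable_atLeastAtMost')
     (rule continuous_on_subset[OF assms], auto)

lemma primitive_has_derivative:
  fixes v :: "real \<Rightarrow> real"
  assumes "continuous_on {0..} v" "t > 0"
  shows "((\<lambda>t. LINT s:{0..t}|lborel. v s) has_vector_derivative v t) (at t)"
proof -
  note eq = primitive_eq_integral[OF assms(1)]
  have "((\<lambda>u. integral {0..u} v) has_vector_derivative v t) (at t within {0..t+1})"
    using assms by (intro integral_has_vector_derivative) (auto intro: continuous_on_subset)
  then show ?thesis
    unfolding eq using assms(2) by (simp add: at_within_Icc_at)
qed

text \<open>\<open>primitive_has_derivative\<close> covers t > 0 only; continuity at the endpoint 0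
  supplies the boundary value in the integration by parts.\<close>

lemma primitive_continuous_on:
  fixes v :: "real \<Rightarrow> real"
  assumes "continuous_on {0..} v"
  shows "continuous_on {0..} (\<lambda>t. LINT s:{0..t}|lborel. v s)"
proof -
  note eq = primitive_eq_integral[OF assms(1)]
  have "continuous (at t within {0..}) (\<lambda>u. integral {0..u} v)" if "t \<ge> 0" for t
  proof -
    have "continuous_on {0..t+1} (\<lambda>u. integral {0..u} v)"
      using assms by (intro indefinite_integral_continuous_1 integrable_continuous_real)
        (auto intro: continuous_on_subset)
    then have "continuous (at t within {0..t+1}) (\<lambda>u. integral {0..u} v)"
      using that by (auto simp: continuous_on_eq_continuous_within)
    moreover have "at t within {0..t+1} = at t within {0..}"
      using that by (intro at_within_nhd[where S = "{..<t+1}"]) auto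
    ultimately show ?thesis by (simp add: continuous_within)
  qed
  then show ?thesis
    unfolding eq by (auto simp: continuous_on_eq_continuous_within)
qed

lemma primitive_bounded:
  fixes v :: "real \<Rightarrow> real"
  assumes "set_integrable lborel {0..} v"
  shows "\<bar>LINT s:{0..t}|lborel. v s\<bar> \<le> (LINT s:{0..}|lborel. \<bar>v s\<bar>)"
proof -
  have i: "set_integrable lborel {0..t} v"
    by (rule set_integrable_subset[OF assms]) auto
  have "\<bar>LINT s:{0..t}|lborel. v s\<bar> \<le> (LINT s:{0..t}|lborel. \<bar>v s\<bar>)"
    using integral_abs_bound[of lborel "\<lambda>s. indicator {0..t} s *\<^sub>R v s"]
    by (simp add: set_lebesgue_integral_def abs_mult)
  also have "\<dots> \<le> (LINT s:{0..}|lborel. \<bar>v s\<bar>)"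
    unfolding set_lebesgue_integral_def
    using set_integrable_abs[OF i] set_integrable_abs[OF assms]
    by (intro integral_mono) (auto simp: set_integrable_def indicator_def)
  finally show ?thesis .
qed

text \<open>Integration by parts: \<open>exp (- lam * t) * X t\<close> vanishes at 0 because
  \<open>X 0 = 0\<close>, and at infinity because \<open>X\<close> is bounded, so its derivative
  \<open>f\<close> has integral 0. The position is thereby traded for the velocity.\<close>

lemma exp_weighted_primitive:
  fixes v :: "real \<Rightarrow> real"
  assumes lam: "lam > 0" and cont: "continuous_on {0..} v" and int: "set_integrable lborel {0..} v"
    and B: "\<And>t. t \<ge> 0 \<Longrightarrow> \<bar>v t\<bar> \<le> B"
  defines "X \<equiv> \<lambda>t. LINT s:{0..t}|lborel. v s"
  shows "set_integrable lborel {0..} (\<lambda>t. exp (- lam * t) * X t)"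
    and "lam * (LINT t:{0..}|lborel. exp (- lam * t) * X t) = (LINT t:{0..}|lborel. exp (- lam * t) * v t)"
proof -
  define K where "K = (LINT s:{0..}|lborel. \<bar>v s\<bar>)"
  have XK: "\<bar>X t\<bar> \<le> K" for t
    unfolding X_def K_def by (rule primitive_bounded[OF int])
  have Xc: "continuous_on {0..} X"
    unfolding X_def by (rule primitive_continuous_on[OF cont])
  show iX: "set_integrable lborel {0..} (\<lambda>t. exp (- lam * t) * X t)"
    by (rule set_integrable_exp_weighted[OF lam Xc XK])
  have iv: "set_integrable lborel {0..} (\<lambda>t. exp (- lam * t) * v t)"
    by (rule set_integrable_exp_weighted[OF lam cont B])
  define f where "f t = exp (- lam * t) * v t - lam * (exp (- lam * t) * X t)" for t
  have "(LBINT t=0..\<infinity>. f t) = 0 - 0"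
  proof (rule interval_integral_FTC_integrable)
    show "((\<lambda>t. exp (- lam * t) * X t) has_vector_derivative f t) (at t)" if "0 < ereal t" for t
    proof -
      have "(X has_field_derivative v t) (at t)"
        using primitive_has_derivative[OF cont, of t] that
        by (simp add: X_def has_real_derivative_iff_has_vector_derivative)
      then have "((\<lambda>t. exp (- lam * t) * X t) has_field_derivative f t) (at t)"
        unfolding f_def by (auto intro!: derivative_eq_intros)
      then show ?thesis
        by (simp add: has_real_derivative_iff_has_vector_derivative)
    qed
    show "isCont f t" if "0 < ereal t" for t
    proof -
      have "continuous_on {0<..} f"
        unfolding f_def
        by (intro continuous_intros continuous_on_subset[OF cont] continuous_on_subset[OF Xc]) auto
      then show ?thesis
        using that by (auto simp: continuous_on_eq_continuous_at open_greaterThan)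
    qed
    have "set_integrable lborel {0..} f"
      unfolding f_def by (intro set_integral_diff iv set_integrable_mult_right iX)
    then show "set_integrable lborel (einterval 0 \<infinity>) f"
      by (rule set_integrable_subset) (auto simp: einterval_def)
    have "((\<lambda>t. exp (- lam * t) * X t) \<longlongrightarrow> exp (- lam * 0) * X 0) (at_right 0)"
    proof (rule tendsto_within_subset)
      have "continuous_on {0..} (\<lambda>t. exp (- lam * t) * X t)"
        by (intro continuous_intros Xc)
      then show "((\<lambda>t. exp (- lam * t) * X t) \<longlongrightarrow> exp (- lam * 0) * X 0) (at 0 within {0..})"
        unfolding continuous_on_def by (rule bspec) simp
    qed auto
    moreover have "X 0 = 0"
      by (simp add: X_def primitive_eq_integral[OF cont])
    ultimately show "(((\<lambda>t. exp (- lam * t) * X t) \<circ> real_of_ereal) \<longlongrightarrow> 0) (at_right 0)"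
      by (simp add: ereal_tendsto_simps zero_ereal_def)
    have "((\<lambda>t. exp (- lam * t) * X t) \<longlongrightarrow> 0) at_top"
    proof (rule Lim_null_comparison)
      show "\<forall>\<^sub>F t in at_top. norm (exp (- lam * t) * X t) \<le> exp (- lam * t) * K"
        using XK by (auto simp: abs_mult)
      have "((\<lambda>t. exp (- lam * t)) \<longlongrightarrow> 0) at_top"
        using lam by real_asymp
      then show "((\<lambda>t. exp (- lam * t) * K) \<longlongrightarrow> 0) at_top"
        by (rule tendsto_mult_left_zero)
    qed
    then show "(((\<lambda>t. exp (- lam * t) * X t) \<circ> real_of_ereal) \<longlongrightarrow> 0) (at_left \<infinity>)"
      by (simp add: ereal_tendsto_simps)
  qed simp
  then have "(LINT t:{0<..}|lborel. f t) = 0"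
    by (simp add: interval_integral_to_infinity_eq zero_ereal_def)
  \<comment> \<open>The fundamental theorem yields the open half-line; the point 0 is a null
    set.\<close>
  moreover have "(LINT t:{0<..}|lborel. f t) = (LINT t:{0..}|lborel. f t)"
  proof -
    have "AE t in lborel. indicator {0<..} t *\<^sub>R f t = indicator {0..} t *\<^sub>R f t"
      using AE_lborel_singleton[of "0::real"] by eventually_elim (auto simp: indicator_def)
    moreover have "continuous_on {0<..} f" "continuous_on {0..} f"
      unfolding f_def
      by (intro continuous_intros continuous_on_subset[OF cont] continuous_on_subset[OF Xc]; force)+
    ultimately show ?thesis
      unfolding set_lebesgue_integral_def using borel_measurable_continuous_on_indicator[of _ f]
      by (intro integral_cong_AE) auto
  qed
  moreover have "(LINT t:{0..}|lborel. f t) = (LINT t:{0..}|lborel. exp (- lam * t) * v t)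
      - lam * (LINT t:{0..}|lborel. exp (- lam * t) * X t)"
    unfolding f_def using iv set_integrable_mult_right[of lam, OF iX]
    by (simp only: set_integral_diff(2) set_integral_mult_right)
  ultimately show "lam * (LINT t:{0..}|lborel. exp (- lam * t) * X t) = (LINT t:{0..}|lborel. exp (- lam * t) * v t)"
    by simp
qed

section \<open>The cost and its variational inequality\<close>

lemma trajW_D:
  assumes "w \<in> trajW \<alpha> \<beta> vmax v0 d"
  shows "lipschitz_ab \<alpha> \<beta> w" "continuous_on {0..} w" "set_integrable lborel {0..} w"
    "\<And>t. t \<ge> 0 \<Longrightarrow> 0 \<le> w t" "\<And>t. t \<ge> 0 \<Longrightarrow> w t \<le> vmax"
    "\<And>t. t \<ge> 0 \<Longrightarrow> \<bar>w t\<bar> \<le> vmax" "w 0 = v0" "(LINT t:{0..}|lborel. w t) \<le> d"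
  using assms by (auto simp: trajW_def intro: lipschitz_ab_continuous_on)

text \<open>All conditions defining \<open>trajW\<close> are bounds or equations for linear
  expressions in the profile, so they pass to convex combinations. A minimiser may therefore be
  moved a little towards any competitor.\<close>

lemma trajW_segment:
  assumes v: "v \<in> trajW \<alpha> \<beta> vmax v0 d" and w: "w \<in> trajW \<alpha> \<beta> vmax v0 d"
    and \<theta>: "0 \<le> \<theta>" "\<theta> \<le> 1"
  shows "(\<lambda>t. (1 - \<theta>) * v t + \<theta> * w t) \<in> trajW \<alpha> \<beta> vmax v0 d"
proof -
  let ?u = "\<lambda>t. (1 - \<theta>) * v t + \<theta> * w t"
  have conv: "l \<le> (1 - \<theta>) * x + \<theta> * y" "(1 - \<theta>) * x' + \<theta> * y' \<le> r"
    if "l \<le> x" "l \<le> y" "x' \<le> r" "y' \<le> r" for l r x y x' y' :: real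
  proof -
    have "(1 - \<theta>) * l + \<theta> * l \<le> (1 - \<theta>) * x + \<theta> * y" "(1 - \<theta>) * x' + \<theta> * y' \<le> (1 - \<theta>) * r + \<theta> * r"
      using \<theta> that by (intro add_mono mult_left_mono; simp)+
    then show "l \<le> (1 - \<theta>) * x + \<theta> * y" "(1 - \<theta>) * x' + \<theta> * y' \<le> r"
      by (simp_all add: algebra_simps)
  qed
  have "lipschitz_ab \<alpha> \<beta> ?u"
    unfolding lipschitz_ab_def
  proof (intro allI impI)
    fix s t :: real assume st: "0 \<le> s" "s \<le> t"
    have eq: "?u t - ?u s = (1 - \<theta>) * (v t - v s) + \<theta> * (w t - w s)"
      by (simp add: algebra_simps)
    show "- \<beta> * (t - s) \<le> ?u t - ?u s \<and> ?u t - ?u s \<le> \<alpha> * (t - s)"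
      unfolding eq using trajW_D(1)[OF v] trajW_D(1)[OF w] st
      by (intro conjI conv) (auto simp: lipschitz_ab_def)
  qed
  moreover have "0 \<le> ?u t \<and> ?u t \<le> vmax" if "t \<ge> 0" for t
    using trajW_D(4,5)[OF v] trajW_D(4,5)[OF w] that by (intro conjI conv) auto
  moreover have "set_integrable lborel {0..} ?u"
    by (intro set_integral_add set_integrable_mult_right trajW_D(3)[OF v] trajW_D(3)[OF w])
  moreover have "(LINT t:{0..}|lborel. ?u t) \<le> d"
    using trajW_D(3,8)[OF v] trajW_D(3,8)[OF w] by (subst set_integral_add(2)) (auto intro!: conv)
  ultimately show ?thesis
    using trajW_D(7)[OF v] trajW_D(7)[OF w] by (auto simp: trajW_def algebra_simps)
qed

text \<open>The position enters the cost linearly, and \<open>exp_weighted_primitive\<close>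
  replaces it by the velocity. The resulting linear term turns \<open>vmax\<close> into
  \<open>A_const\<close> in the quadratic. The first summand does not depend on \<open>w\<close> and
  cancels when costs are compared.\<close>

lemma Scost_exponential:
  assumes pos: "\<alpha> > 0" "vmax > 0" "lam > 0" and w: "w \<in> trajW \<alpha> \<beta> vmax v0 d"
  shows "Scost \<alpha> vmax L (exponential_density lam) w =
    lam * (LINT t:{0..}|lborel. t * exp (- lam * t) + (vmax / (2 * \<alpha>) + L / vmax) * exp (- lam * t)) +
    lam / (2 * \<alpha> * vmax) *
      (LINT t:{0..}|lborel. exp (- lam * t) * ((w t)\<^sup>2 - 2 * A_const \<alpha> vmax lam * w t))"
proof -
  note W = trajW_D[OF w]
  define A where "A = A_const \<alpha> vmax lam"
  define X where "X t = (LINT s:{0..t}|lborel. w s)" for t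
  define K where "K = vmax / (2 * \<alpha>) + L / vmax"
  let ?e = "\<lambda>t. exp (- lam * t)"
  let ?f = "\<lambda>t. t * ?e t + K * ?e t" and ?g = "\<lambda>t. ?e t * ((w t)\<^sup>2 - 2 * A * w t)"
    and ?h = "\<lambda>t. ?e t * w t - lam * (?e t * X t)"
  have X: "set_integrable lborel {0..} (\<lambda>t. ?e t * X t)"
    "lam * (LINT t:{0..}|lborel. ?e t * X t) = (LINT t:{0..}|lborel. ?e t * w t)"
    unfolding X_def using exp_weighted_primitive[OF pos(3) W(2,3,6)] by auto
  have f: "set_integrable lborel {0..} ?f"
    by (intro set_integral_add set_integrable_mult_right set_integrable_exponential pos)
  have ew: "set_integrable lborel {0..} (\<lambda>t. ?e t * w t)"
    by (rule set_integrable_exp_weighted[OF pos(3) W(2,6)])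
  have g: "set_integrable lborel {0..} ?g"
  proof (rule set_integrable_exp_weighted[OF pos(3)])
    show "continuous_on {0..} (\<lambda>t. (w t)\<^sup>2 - 2 * A * w t)"
      by (intro continuous_intros W)
    fix t :: real assume "t \<ge> 0"
    then have wt: "\<bar>w t\<bar> \<le> vmax" by (rule W)
    have "\<bar>(w t)\<^sup>2 - 2 * A * w t\<bar> \<le> \<bar>w t\<bar>\<^sup>2 + 2 * \<bar>A\<bar> * \<bar>w t\<bar>"
      by (rule order_trans[OF abs_triangle_ineq4]) (simp add: abs_mult)
    also have "\<dots> \<le> vmax\<^sup>2 + 2 * \<bar>A\<bar> * vmax"
      using wt pos(2) by (intro add_mono power_mono mult_left_mono) auto
    finally show "\<bar>(w t)\<^sup>2 - 2 * A * w t\<bar> \<le> vmax\<^sup>2 + 2 * \<bar>A\<bar> * vmax" .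
  qed
  have h: "set_integrable lborel {0..} ?h"
    by (intro set_integral_diff set_integrable_mult_right ew X)
  have h0: "(LINT t:{0..}|lborel. ?h t) = 0"
    using X(2) ew set_integrable_mult_right[of lam, OF X(1)]
    by (simp only: set_integral_diff(2) set_integral_mult_right)
  \<comment> \<open>The last bracket is the integrand \<open>?h\<close> of integral 0; its term
    \<open>e * y\<close> cancels the contribution of \<alpha> / lam in \<open>A\<close>.\<close>
  have alg: "(t + (1 / (2 * \<alpha> * vmax) * (vmax - y)\<^sup>2 + 1 / vmax * (L - x))) * (lam * e) =
      lam * (t * e + K * e) + (lam / (2 * \<alpha> * vmax) * (e * (y\<^sup>2 - 2 * A * y)) + 1 / vmax * (e * y - lam * (e * x)))"
    for t x y e
    using pos by (simp add: K_def A_def A_const_def field_simps power2_eq_square)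
  have "Scost \<alpha> vmax L (exponential_density lam) w =
      (LINT t:{0..}|lborel. lam * ?f t + (lam / (2 * \<alpha> * vmax) * ?g t + 1 / vmax * ?h t))"
    unfolding Scost_def kcost_def X_def[symmetric]
  proof (rule set_lebesgue_integral_cong; (intro allI impI)?)
    fix t :: real assume "t \<in> {0..}"
    then have "exponential_density lam t = lam * exp (- lam * t)"
      by (simp add: exponential_density_def mult.commute)
    then show "(t + (1 / (2 * \<alpha> * vmax) * (vmax - w t)\<^sup>2 + 1 / vmax * (L - X t))) * exponential_density lam t
      = lam * ?f t + (lam / (2 * \<alpha> * vmax) * ?g t + 1 / vmax * ?h t)"
      by (simp only: alg)
  qed simp
  also have "\<dots> = lam * (LINT t:{0..}|lborel. ?f t) +
      (lam / (2 * \<alpha> * vmax) * (LINT t:{0..}|lborel. ?g t) + 1 / vmax * (LINT t:{0..}|lborel. ?h t))"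
    using set_integrable_mult_right[of lam, OF f] set_integrable_mult_right[of "lam / (2 * \<alpha> * vmax)", OF g]
      set_integrable_mult_right[of "1 / vmax", OF h]
    by (simp only: set_integral_add set_integral_mult_right)
  finally show ?thesis
    unfolding h0 by (simp add: K_def A_def)
qed

text \<open>Along the segment from \<open>v\<close> to \<open>w\<close> the quadratic cost changes
  by a positive multiple of \<open>\<theta> * (2 * I + \<theta> * Q)\<close>. Minimality makes this
  nonnegative; dividing by \<theta> and letting \<theta> tend to 0 from the right leaves
  \<open>I\<close>.\<close>

lemma optimal_variational_inequality:
  assumes pos: "\<alpha> > 0" "vmax > 0" "lam > 0"
    and opt: "optimal_trajectory \<alpha> \<beta> vmax v0 d L (exponential_density lam) v"
    and w: "w \<in> trajW \<alpha> \<beta> vmax v0 d"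
  shows "0 \<le> (LINT t:{0..}|lborel. exp (- lam * t) * ((v t - A_const \<alpha> vmax lam) * (w t - v t)))"
proof -
  define A where "A = A_const \<alpha> vmax lam"
  have v: "v \<in> trajW \<alpha> \<beta> vmax v0 d"
    using opt by (simp add: optimal_trajectory_def trajV_def)
  note V = trajW_D[OF v] and W = trajW_D[OF w]
  let ?e = "\<lambda>t. exp (- lam * t)"
  let ?i = "\<lambda>t. ?e t * ((v t - A) * (w t - v t))" and ?q = "\<lambda>t. ?e t * (w t - v t)\<^sup>2"
    and ?j = "\<lambda>u t. ?e t * ((u t)\<^sup>2 - 2 * A * u t)"
  define I where "I = (LINT t:{0..}|lborel. ?i t)"
  define Q where "Q = (LINT t:{0..}|lborel. ?q t)"
  have d: "\<bar>w t - v t\<bar> \<le> vmax" if "t \<ge> 0" for t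
    using V(4,5)[OF that] W(4,5)[OF that] by (auto simp: abs_le_iff)
  have i: "set_integrable lborel {0..} ?i"
  proof (rule set_integrable_exp_weighted[OF pos(3)])
    show "continuous_on {0..} (\<lambda>t. (v t - A) * (w t - v t))"
      by (intro continuous_intros V W)
    show "\<bar>(v t - A) * (w t - v t)\<bar> \<le> (vmax + \<bar>A\<bar>) * vmax" if "t \<ge> 0" for t
      unfolding abs_mult using d[OF that] V(6)[OF that] pos(2) by (intro mult_mono) auto
  qed
  have q: "set_integrable lborel {0..} ?q"
  proof (rule set_integrable_exp_weighted[OF pos(3)])
    show "continuous_on {0..} (\<lambda>t. (w t - v t)\<^sup>2)"
      by (intro continuous_intros V W)
    show "\<bar>(w t - v t)\<^sup>2\<bar> \<le> vmax\<^sup>2" if "t \<ge> 0" for t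
      using power_mono[OF d[OF that], of 2] by simp
  qed
  have jv: "set_integrable lborel {0..} (?j v)"
  proof (rule set_integrable_exp_weighted[OF pos(3)])
    show "continuous_on {0..} (\<lambda>t. (v t)\<^sup>2 - 2 * A * v t)"
      by (intro continuous_intros V)
    show "\<bar>(v t)\<^sup>2 - 2 * A * v t\<bar> \<le> vmax * (vmax + 2 * \<bar>A\<bar>)" if "t \<ge> 0" for t
    proof -
      have "\<bar>v t - 2 * A\<bar> \<le> vmax + 2 * \<bar>A\<bar>"
        using V(6)[OF that] by auto
      then have "\<bar>v t * (v t - 2 * A)\<bar> \<le> vmax * (vmax + 2 * \<bar>A\<bar>)"
        unfolding abs_mult using V(6)[OF that] pos(2) by (intro mult_mono) auto
      then show ?thesis by (simp add: power2_eq_square algebra_simps)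
    qed
  qed
  have step: "0 \<le> 2 * I + \<theta> * Q" if \<theta>: "0 < \<theta>" "\<theta> \<le> 1" for \<theta>
  proof -
    let ?u = "\<lambda>t. (1 - \<theta>) * v t + \<theta> * w t"
    have u: "?u \<in> trajW \<alpha> \<beta> vmax v0 d"
      using \<theta> by (intro trajW_segment v w) auto
    have "Scost \<alpha> vmax L (exponential_density lam) v \<le> Scost \<alpha> vmax L (exponential_density lam) ?u"
      using opt u by (simp add: optimal_trajectory_def)
    then have "lam / (2 * \<alpha> * vmax) * (LINT t:{0..}|lborel. ?j v t)
        \<le> lam / (2 * \<alpha> * vmax) * (LINT t:{0..}|lborel. ?j ?u t)"
      unfolding Scost_exponential[OF pos v] Scost_exponential[OF pos u] A_def[symmetric] by simp
    then have "(LINT t:{0..}|lborel. ?j v t) \<le> (LINT t:{0..}|lborel. ?j ?u t)"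
      by (rule mult_left_le_imp_le) (simp add: pos)
    also have "?j ?u = (\<lambda>t. ?j v t + (2 * \<theta> * ?i t + \<theta>\<^sup>2 * ?q t))"
      by (rule ext) (simp add: algebra_simps power2_eq_square)
    also have "(LINT t:{0..}|lborel. ?j v t + (2 * \<theta> * ?i t + \<theta>\<^sup>2 * ?q t)) =
        (LINT t:{0..}|lborel. ?j v t) + (2 * \<theta> * I + \<theta>\<^sup>2 * Q)"
      unfolding I_def Q_def
      using jv set_integrable_mult_right[of "2 * \<theta>", OF i] set_integrable_mult_right[of "\<theta>\<^sup>2", OF q]
      by (simp only: set_integral_add set_integral_mult_right)
    finally have "0 \<le> \<theta> * (2 * I + \<theta> * Q)"
      by (simp add: algebra_simps power2_eq_square)
    then show ?thesis
      using \<theta> by (simp add: zero_le_mult_iff)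
  qed
  have "((\<lambda>\<theta>. 2 * I + \<theta> * Q) \<longlongrightarrow> 2 * I + 0 * Q) (at_right 0)"
    by (intro tendsto_intros)
  moreover have "\<forall>\<^sub>F \<theta> in at_right 0. 0 \<le> 2 * I + \<theta> * Q"
    unfolding eventually_at_right_field using step by (intro exI[of _ 1]) auto
  ultimately have "0 \<le> 2 * I + 0 * Q"
    by (rule tendsto_lowerbound) simp
  then show ?thesis
    by (simp add: I_def A_def)
qed

section \<open>The switching function\<close>

lemma Fcal_at_most_one_positive_zero:
  assumes pos: "\<alpha> > 0" "\<beta> > 0" "vmax > 0" "lam > 0"
    and zeros: "x > 0" "Fcal \<alpha> \<beta> vmax lam x = 0" "y > 0" "Fcal \<alpha> \<beta> vmax lam y = 0"
  shows "x = y"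
proof -
  define c where "c = \<beta> + lam * A_const \<alpha> vmax lam"
  have c: "c > 0"
    using pos by (simp add: c_def A_const_def add_pos_pos)
  define F1 where "F1 z = - 2 * lam\<^sup>2 / \<beta> * z + lam / \<beta> * c - lam / \<beta> * exp (- lam * z / \<beta>) * c" for z
  define F2 where "F2 z = - 2 * lam\<^sup>2 / \<beta> + (lam / \<beta>)\<^sup>2 * exp (- lam * z / \<beta>) * c" for z
  have D1: "(Fcal \<alpha> \<beta> vmax lam has_real_derivative F1 z) (at z)" for z
    unfolding Fcal_def[abs_def] c_def[symmetric] F1_def using pos
    by (auto intro!: derivative_eq_intros simp: field_simps power2_eq_square)
  have D2: "(F1 has_real_derivative F2 z) (at z)" for z
    unfolding F1_def[abs_def] F2_def using pos
    by (auto intro!: derivative_eq_intros simp: field_simps power2_eq_square)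
  have F2_less: "F2 z < F2 y" if "y < z" for y z
    unfolding F2_def using that pos c
    by (auto intro!: mult_strict_right_mono mult_strict_left_mono simp: divide_strict_right_mono)
  have F0: "Fcal \<alpha> \<beta> vmax lam 0 = 0" and F10: "F1 0 = 0"
    by (auto simp: Fcal_def F1_def)
  \<comment> \<open>Rolle on the zeros 0 < x < y gives zeros p < q of \<open>F1\<close>; since also
    \<open>F1 0 = 0\<close>, Rolle again gives zeros r < p < s of the strictly decreasing
    \<open>F2\<close>.\<close>
  have False if xy: "0 < x" "x < y" and z: "Fcal \<alpha> \<beta> vmax lam x = 0" "Fcal \<alpha> \<beta> vmax lam y = 0" for x y
  proof -
    have rolle1: "\<exists>p>x. p < y \<and> F1 p = 0" if "x < y" "Fcal \<alpha> \<beta> vmax lam x = Fcal \<alpha> \<beta> vmax lam y" for x y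
      using MVT2[OF that(1) D1] that by auto
    have rolle2: "\<exists>p>x. p < y \<and> F2 p = 0" if "x < y" "F1 x = F1 y" for x y
      using MVT2[OF that(1) D2] that by auto
    obtain p where p: "0 < p" "p < x" "F1 p = 0"
      using rolle1[of 0 x] xy z F0 by auto
    obtain q where q: "x < q" "q < y" "F1 q = 0"
      using rolle1[of x y] xy z by auto
    obtain r where r: "0 < r" "r < p" "F2 r = 0"
      using rolle2[of 0 p] p F10 by auto
    obtain s where s: "p < s" "s < q" "F2 s = 0"
      using rolle2[of p q] p q by auto
    show False
      using F2_less[of r s] r s by simp
  qed
  then show ?thesis
    using zeros by (meson linorder_neqE)
qed

text \<open>The integrand is the first variation along the braking line, plus the constant that
  makes it vanish at \<open>tc\<close>. That constant is the parameter \<open>b\<close> of the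
  Euler--Lagrange curve through velocity \<open>vc\<close> at time \<open>tc\<close>.\<close>

lemma Fcal_eq_integral:
  assumes pos: "\<beta> > 0" "lam > 0" "vc \<ge> 0"
  shows "Fcal \<alpha> \<beta> vmax lam vc = lam\<^sup>2 * exp (lam * tc) *
    (LINT t:{tc..tc + vc / \<beta>}|lborel. exp (- lam * t) * (vc - \<beta> * (t - tc) - A_const \<alpha> vmax lam)
       + (A_const \<alpha> vmax lam - vc) * exp (- lam * tc))"
proof -
  define A where "A = A_const \<alpha> vmax lam"
  define b where "b = (A - vc) * exp (- lam * tc)"
  let ?f = "\<lambda>t. exp (- lam * t) * (vc - \<beta> * (t - tc) - A) + b"
  \<comment> \<open>Antiderivative of \<open>?f\<close> by parts:
    \<open>\<beta> / lam\<^sup>2\<close> absorbs the term produced by differentiating the linear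
    factor.\<close>
  define G where "G t = b * t + exp (- lam * t) * ((A - vc + \<beta> * (t - tc)) / lam + \<beta> / lam\<^sup>2)" for t
  have G: "(G has_vector_derivative ?f t) (at t within S)" for t S
  proof -
    have "(G has_real_derivative ?f t) (at t within S)"
      unfolding G_def[abs_def] using pos
      by (auto intro!: derivative_eq_intros simp: field_simps power2_eq_square)
    then show ?thesis by (simp add: has_real_derivative_iff_has_vector_derivative)
  qed
  have "(LINT t:{tc..tc + vc / \<beta>}|lborel. ?f t) = G (tc + vc / \<beta>) - G tc"
    unfolding set_lebesgue_integral_def
    using pos by (intro integral_FTC_atLeastAtMost G continuous_intros) auto
  moreover have "lam\<^sup>2 * exp (lam * tc) * (G (tc + vc / \<beta>) - G tc) = Fcal \<alpha> \<beta> vmax lam vc"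
  proof -
    have e: "exp (- lam * (tc + vc / \<beta>)) = exp (- lam * tc) * exp (- lam * vc / \<beta>)"
      by (simp add: exp_add[symmetric] algebra_simps)
    have "G (tc + vc / \<beta>) - G tc = exp (- lam * tc) *
      ((A - vc) * (vc / \<beta>) + exp (- lam * vc / \<beta>) * (A / lam + \<beta> / lam\<^sup>2) - ((A - vc) / lam + \<beta> / lam\<^sup>2))"
    proof -
      have alg: "B * e * (s + q) + e * e' * x - (B * e * s + e * y) = e * (B * q + e' * x - y)"
        for B e e' s q x y :: real by (simp add: algebra_simps)
      have "\<beta> * (tc + vc / \<beta> - tc) = vc" using pos by simp
      then show ?thesis
        unfolding G_def e b_def using alg[of "A - vc"] by simp
    qed
    moreover have "exp (lam * tc) * (exp (- lam * tc) * z) = z" for z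
      by (simp add: exp_minus)
    ultimately have "lam\<^sup>2 * exp (lam * tc) * (G (tc + vc / \<beta>) - G tc) =
      lam\<^sup>2 * ((A - vc) * (vc / \<beta>) + exp (- lam * vc / \<beta>) * (A / lam + \<beta> / lam\<^sup>2) - ((A - vc) / lam + \<beta> / lam\<^sup>2))"
      by (simp only: mult.assoc)
    also have "\<dots> = Fcal \<alpha> \<beta> vmax lam vc"
      unfolding Fcal_def A_def[symmetric] using pos by (simp add: field_simps power2_eq_square)
    finally show ?thesis .
  qed
  ultimately show ?thesis
    by (simp add: A_def b_def)
qed

section \<open>Functions of bounded slope\<close>

text \<open>A localised \<open>lipschitz_ab\<close> with free slope bounds, so that a piecewise
  profile can be checked piece by piece and glued.\<close>

definition slope_on :: "real \<Rightarrow> real \<Rightarrow> real set \<Rightarrow> (real \<Rightarrow> real) \<Rightarrow> bool" where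
  "slope_on l u S g \<longleftrightarrow>
     (\<forall>s\<in>S. \<forall>t\<in>S. s \<le> t \<longrightarrow> l * (t - s) \<le> g t - g s \<and> g t - g s \<le> u * (t - s))"

lemma lipschitz_ab_iff_slope_on: "lipschitz_ab \<alpha> \<beta> g \<longleftrightarrow> slope_on (- \<beta>) \<alpha> {0..} g"
  by (auto simp: lipschitz_ab_def slope_on_def)

lemma slope_onD:
  assumes "slope_on l u S g" "s \<in> S" "t \<in> S" "s \<le> t"
  shows "l * (t - s) \<le> g t - g s" "g t - g s \<le> u * (t - s)"
  using assms by (auto simp: slope_on_def)

lemma slope_on_weaken:
  assumes "slope_on l u S g" "l' \<le> l" "u \<le> u'" "T \<subseteq> S"
  shows "slope_on l' u' T g"
  unfolding slope_on_def
proof (intro ballI impI)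
  fix s t assume st: "s \<in> T" "t \<in> T" "s \<le> t"
  then have "l' * (t - s) \<le> l * (t - s)" "u * (t - s) \<le> u' * (t - s)"
    using assms by (auto intro: mult_right_mono)
  moreover have "l * (t - s) \<le> g t - g s" "g t - g s \<le> u * (t - s)"
    using slope_onD[OF assms(1)] st assms(4) by blast+
  ultimately show "l' * (t - s) \<le> g t - g s \<and> g t - g s \<le> u' * (t - s)"
    by linarith
qed

lemma slope_on_cong:
  assumes "\<And>t. t \<in> S \<Longrightarrow> f t = g t"
  shows "slope_on l u S f \<longleftrightarrow> slope_on l u S g"
  using assms by (simp add: slope_on_def)

lemma slope_on_add:
  assumes "slope_on l u S f" "slope_on l' u' S g"
  shows "slope_on (l + l') (u + u') S (\<lambda>t. f t + g t)"
  unfolding slope_on_def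
proof (intro ballI impI)
  fix s t assume st: "s \<in> S" "t \<in> S" "s \<le> t"
  show "(l + l') * (t - s) \<le> f t + g t - (f s + g s) \<and> f t + g t - (f s + g s) \<le> (u + u') * (t - s)"
    using slope_onD[OF assms(1) st] slope_onD[OF assms(2) st] by (simp add: distrib_right)
qed

text \<open>An increment from a point of \<open>S\<close> to a point of \<open>T\<close> splits at
  the common point \<open>c\<close>.\<close>

lemma slope_on_glue:
  assumes S: "slope_on l u S g" "c \<in> S" "\<And>x. x \<in> S \<Longrightarrow> x \<le> c"
    and T: "slope_on l u T g" "c \<in> T" "\<And>x. x \<in> T \<Longrightarrow> c \<le> x"
  shows "slope_on l u (S \<union> T) g"
  unfolding slope_on_def
proof (intro ballI impI)
  fix s t assume st: "s \<in> S \<union> T" "t \<in> S \<union> T" "s \<le> t"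
  consider "s \<in> S" "t \<in> S" | "s \<in> T" "t \<in> T" | "s \<in> S" "t \<in> T" | "s = t"
    using st S(3) T(3) by force
  then show "l * (t - s) \<le> g t - g s \<and> g t - g s \<le> u * (t - s)"
  proof cases
    case 3
    have "l * (c - s) \<le> g c - g s" "g c - g s \<le> u * (c - s)"
      using slope_onD[OF S(1)] S(2,3) 3 by blast+
    moreover have "l * (t - c) \<le> g t - g c" "g t - g c \<le> u * (t - c)"
      using slope_onD[OF T(1)] T(2,3) 3 by blast+
    ultimately show ?thesis by (simp add: algebra_simps)
  qed (use slope_onD[OF S(1)] slope_onD[OF T(1)] st(3) in auto)
qed

lemma slope_on_derivative:
  assumes "\<And>t. a \<le> t \<Longrightarrow> t \<le> c \<Longrightarrow> (g has_real_derivative g' t) (at t)"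
    and "\<And>t. a \<le> t \<Longrightarrow> t \<le> c \<Longrightarrow> l \<le> g' t \<and> g' t \<le> u"
  shows "slope_on l u {a..c} g"
  unfolding slope_on_def
proof (intro ballI impI)
  fix s t assume st: "s \<in> {a..c}" "t \<in> {a..c}" "s \<le> t"
  show "l * (t - s) \<le> g t - g s \<and> g t - g s \<le> u * (t - s)"
  proof (cases "s = t")
    case False
    then have "s < t" using st by simp
    then obtain z where z: "s < z" "z < t" "g t - g s = (t - s) * g' z"
      using MVT2[of s t g g'] assms(1) st by auto
    have "l \<le> g' z" "g' z \<le> u"
      using assms(2)[of z] z st by auto
    then have "l * (t - s) \<le> g' z * (t - s)" "g' z * (t - s) \<le> u * (t - s)"
      using \<open>s < t\<close> by (auto intro: mult_right_mono)
    then show ?thesis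
      using z(3) by (simp add: mult.commute)
  qed simp
qed

section \<open>Perturbing the switch to slope \<open>-\<beta>\<close>\<close>

lemma integrable_indicator_Icc: "integrable lborel (indicator {a..b} :: real \<Rightarrow> real)"
  by (rule integrable_real_indicator) (auto simp: emeasure_lborel_Icc_eq)

text \<open>The truncation in \<open>braking\<close> describes the final line and the standstill by
  one formula; \<open>t2\<close> is the time at which the line reaches 0.\<close>

locale EL_beta_trajectory =
  fixes \<alpha> \<beta> vmax lam v0 d t0 tc b A vc t2 :: real and v :: "real \<Rightarrow> real"
  defines "A \<equiv> A_const \<alpha> vmax lam" and "vc \<equiv> v tc" and "t2 \<equiv> tc + v tc / \<beta>"
  assumes pos: "\<alpha> > 0" "\<beta> > 0" "vmax > 0" "lam > 0"
    and v: "v \<in> trajV \<alpha> \<beta> vmax v0 d"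
    and times: "0 \<le> t0" "t0 < tc"
    and EL: "\<And>t. t \<in> {t0..tc} \<Longrightarrow> v t = EL_curve \<alpha> vmax lam b t"
    and braking: "\<And>t. t \<ge> tc \<Longrightarrow> v t = max 0 (v tc - \<beta> * (t - tc))"
    and vc_pos: "v tc > 0"
begin

section \<open>Slope and velocity at the end of the Euler--Lagrange phase\<close>

lemma v_W: "v \<in> trajW \<alpha> \<beta> vmax v0 d"
  using v by (simp add: trajV_def)

lemma v_bounds: "t \<ge> 0 \<Longrightarrow> 0 \<le> v t" "t \<ge> 0 \<Longrightarrow> v t \<le> vmax" "t \<ge> 0 \<Longrightarrow> v t \<le> A"
proof -
  have "vmax \<le> A" using pos by (simp add: A_def A_const_def)
  then show "t \<ge> 0 \<Longrightarrow> 0 \<le> v t" "t \<ge> 0 \<Longrightarrow> v t \<le> vmax" "t \<ge> 0 \<Longrightarrow> v t \<le> A"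
    using trajW_D(4,5)[OF v_W, of t] by auto
qed

lemma v_EL: "t \<in> {t0..tc} \<Longrightarrow> v t = A - b * exp (lam * t)"
  using EL by (simp add: EL_curve_def A_def)

text \<open>\<open>A\<close> exceeds \<open>vmax\<close> by \<alpha> / lam > 0, so a curve that
  stays at or below \<open>vmax\<close> at \<open>tc\<close> must lie strictly below
  \<open>A\<close>.\<close>

lemma b_pos: "b > 0"
proof -
  have "v tc < A"
    using v_bounds(2)[of tc] times pos by (simp add: A_def A_const_def add_strict_increasing2 add_pos_pos order.strict_trans1)
  then have "b * exp (lam * tc) > 0"
    using v_EL[of tc] times by simp
  then show ?thesis
    by (simp add: zero_less_mult_iff)
qed

lemma b_eq: "b = (A - vc) * exp (- lam * tc)"
  using v_EL[of tc] times by (simp add: vc_def exp_minus field_simps)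

text \<open>For s in the phase, the secant of \<open>v\<close> over \<open>{s..tc}\<close> has slope
  at least -\<beta>, and convexity of exp bounds the tangent at s by that secant. Letting s tend to
  \<open>tc\<close> gives the bound there, and monotonicity of exp carries it to all earlier times,
  even those before \<open>t0\<close>.\<close>

lemma EL_slope_le:
  assumes "t \<le> tc"
  shows "lam * b * exp (lam * t) \<le> \<beta>"
proof -
  have *: "lam * b * exp (lam * s) \<le> \<beta>" if s: "t0 \<le> s" "s < tc" for s
  proof -
    have "- \<beta> * (tc - s) \<le> v tc - v s"
      using trajW_D(1)[OF v_W] s times by (auto simp: lipschitz_ab_def)
    then have "b * (exp (lam * tc) - exp (lam * s)) \<le> \<beta> * (tc - s)"
      using v_EL[of s] v_EL[of tc] s by (simp add: algebra_simps)
    moreover have "exp (lam * s) * (lam * (tc - s)) \<le> exp (lam * tc) - exp (lam * s)"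
    proof -
      have "exp (lam * s) * (1 + lam * (tc - s)) \<le> exp (lam * s) * exp (lam * (tc - s))"
        by (intro mult_left_mono exp_ge_add_one_self) auto
      then show ?thesis
        by (simp add: exp_add[symmetric] algebra_simps)
    qed
    then have "b * (exp (lam * s) * (lam * (tc - s))) \<le> b * (exp (lam * tc) - exp (lam * s))"
      using b_pos by (intro mult_left_mono) auto
    ultimately have "(lam * b * exp (lam * s)) * (tc - s) \<le> \<beta> * (tc - s)"
      by (simp add: mult_ac)
    then show ?thesis
      using s by simp
  qed
  have "((\<lambda>s. lam * b * exp (lam * s)) \<longlongrightarrow> lam * b * exp (lam * tc)) (at_left tc)"
    by (intro tendsto_intros)
  moreover have "\<forall>\<^sub>F s in at_left tc. lam * b * exp (lam * s) \<le> \<beta>"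
    using eventually_at_left_real[OF times(2)] by eventually_elim (auto intro: *)
  ultimately have "lam * b * exp (lam * tc) \<le> \<beta>"
    by (rule tendsto_upperbound) simp
  moreover have "lam * b * exp (lam * t) \<le> lam * b * exp (lam * tc)"
    using assms pos b_pos by (intro mult_left_mono) auto
  ultimately show ?thesis by simp
qed

text \<open>The curve has slope \<open>- lam * (A - vc)\<close> at \<open>tc\<close>, which is at
  least -\<beta>, and \<open>v_beta\<close> equals \<open>A - \<beta> / lam\<close>.\<close>

lemma v_beta_le: "v_beta \<alpha> \<beta> vmax lam \<le> vc"
proof -
  have "lam * (A - vc) \<le> \<beta>"
    using EL_slope_le[of tc] v_EL[of tc] times by (simp add: vc_def mult.assoc)
  then have "A - vc \<le> \<beta> / lam"
    using pos by (simp add: pos_le_divide_eq mult.commute)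
  then show ?thesis
    by (simp add: v_beta_def A_def A_const_def diff_divide_distrib)
qed

text \<open>The phase has positive length and the curve is strictly decreasing because b >
  0.\<close>

lemma vc_less_vmax: "vc < vmax"
proof -
  have "b * exp (lam * t0) < b * exp (lam * tc)"
    using b_pos pos times by simp
  then have "vc < v t0"
    using v_EL[of t0] v_EL[of tc] times by (simp add: vc_def)
  also have "\<dots> \<le> vmax"
    using v_bounds(2)[of t0] times by simp
  finally show ?thesis .
qed

section \<open>The perturbation of the braking line and its size\<close>

definition mid :: real where
  "mid = (t0 + tc) / 2"

lemma mid: "t0 < mid" "mid < tc"
  using times by (auto simp: mid_def)

text \<open>Shifts the braking line by \<open>\<epsilon>\<close>; the shift is built up on the first half of the
  Euler--Lagrange phase, where the slope stays away from both \<open>-\<beta>\<close> and \<open>0\<close>.\<close>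
definition shift :: "real \<Rightarrow> real \<Rightarrow> real" where
  "shift \<epsilon> t = (if t \<le> t0 then 0
     else if t \<le> mid then \<epsilon> * ((t - t0) / (mid - t0))
     else if t \<le> tc then \<epsilon>
     else max 0 (vc + \<epsilon> - \<beta> * (t - tc)) - max 0 (vc - \<beta> * (t - tc)))"

text \<open>A parabolic arc supported in the first half of the phase. A multiple of it cancels the
  change of the total integral caused by \<open>shift\<close>.\<close>

definition bump :: "real \<Rightarrow> real" where
  "bump t = (if t0 \<le> t \<and> t \<le> mid then (t - t0) * (mid - t) else 0)"

lemma bump_integral:
  "set_integrable lborel {0..} bump" "(LINT t:{0..}|lborel. bump t) > 0"
proof -
  let ?f = "\<lambda>t. (t - t0) * (mid - t)"
  have eq: "indicator {0..} t *\<^sub>R bump t = indicator {t0..mid} t *\<^sub>R ?f t" for t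
    using times by (auto simp: bump_def indicator_def)
  show "set_integrable lborel {0..} bump"
    unfolding set_integrable_def eq unfolding set_integrable_def[symmetric]
    by (intro borel_integrable_atLeastAtMost' continuous_intros)
  define G where "G t = - (t ^ 3) / 3 + (t0 + mid) * t\<^sup>2 / 2 - t0 * mid * t" for t
  have G: "(G has_vector_derivative ?f t) (at t within S)" for t S
    unfolding has_real_derivative_iff_has_vector_derivative[symmetric] G_def[abs_def]
    by (auto intro!: derivative_eq_intros simp: field_simps power2_eq_square)
  have "(LINT t:{0..}|lborel. bump t) = G mid - G t0"
    unfolding set_lebesgue_integral_def eq using mid
    by (intro integral_FTC_atLeastAtMost G continuous_intros) auto
  also have "\<dots> = (mid - t0) ^ 3 / 6"
    by (simp add: G_def field_simps power2_eq_square power3_eq_cube)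
  also have "\<dots> > 0"
    using mid by simp
  finally show "(LINT t:{0..}|lborel. bump t) > 0" .
qed

text \<open>The ramp factor is at most 1 and truncation at 0 does not increase distances. Beyond
  \<open>t2 + \<bar>\<epsilon>\<bar> / \<beta>\<close> both truncated lines are 0.\<close>

lemma shift_bound: "\<bar>shift \<epsilon> t\<bar> \<le> \<bar>\<epsilon>\<bar> * indicator {t0..t2 + \<bar>\<epsilon>\<bar> / \<beta>} t"
proof -
  have tc2: "tc \<le> t2 + \<bar>\<epsilon>\<bar> / \<beta>"
    using pos vc_pos by (simp add: t2_def)
  consider "t \<le> t0" | "t0 < t" "t \<le> mid" | "mid < t" "t \<le> tc" | "tc < t" "t \<le> t2 + \<bar>\<epsilon>\<bar> / \<beta>"
    | "t2 + \<bar>\<epsilon>\<bar> / \<beta> < t" "tc < t"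
    using tc2 by linarith
  then show ?thesis
  proof cases
    case 2
    then have "\<bar>(t - t0) / (mid - t0)\<bar> \<le> 1" using mid by simp
    then have "\<bar>\<epsilon>\<bar> * \<bar>(t - t0) / (mid - t0)\<bar> \<le> \<bar>\<epsilon>\<bar> * 1"
      by (intro mult_left_mono) auto
    then show ?thesis
      using 2 mid tc2 by (simp add: shift_def abs_mult)
  next
    case 5
    then have "vc + \<bar>\<epsilon>\<bar> < \<beta> * (t - tc)"
      using pos by (simp add: t2_def vc_def field_simps)
    then have "vc + \<epsilon> - \<beta> * (t - tc) < 0" "vc - \<beta> * (t - tc) < 0"
      by (simp_all add: abs_if split: if_splits)
    then show ?thesis
      using 5 mid by (simp add: shift_def)
  qed (use mid tc2 in \<open>auto simp: shift_def\<close>)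
qed

text \<open>The shifted line reaches 0 at \<open>t2 + \<epsilon> / \<beta>\<close> instead of
  \<open>t2\<close>, so the shift differs from \<epsilon> on \<open>{tc..t2}\<close> only in a
  window around \<open>t2\<close>. Height and width of the error are both of order \<epsilon>, hence
  its integral is of second order.\<close>

lemma shift_tail:
  assumes "t \<ge> tc" "\<bar>\<epsilon>\<bar> \<le> vc"
  shows "\<bar>shift \<epsilon> t - \<epsilon> * indicator {tc..t2} t\<bar> \<le> \<bar>\<epsilon>\<bar> * indicator {t2 - \<bar>\<epsilon>\<bar> / \<beta>..t2 + \<bar>\<epsilon>\<bar> / \<beta>} t"
proof -
  have line: "vc - \<beta> * (t - tc) = \<beta> * (t2 - t)"
    using pos by (simp add: t2_def vc_def algebra_simps)
  have shifted_line: "vc - \<bar>\<epsilon>\<bar> - \<beta> * (t - tc) = \<beta> * (t2 - \<bar>\<epsilon>\<bar> / \<beta> - t)"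
    "vc + \<bar>\<epsilon>\<bar> - \<beta> * (t - tc) = \<beta> * (t2 + \<bar>\<epsilon>\<bar> / \<beta> - t)"
    using line pos by (simp_all add: algebra_simps)
  have le2: "vc - \<beta> * (t - tc) \<ge> 0" if "t \<le> t2"
    unfolding line using that pos by simp
  have ge2: "vc - \<beta> * (t - tc) \<le> 0" if "t \<ge> t2"
    unfolding line using that pos by (simp add: mult_nonneg_nonpos)
  have le1: "vc - \<bar>\<epsilon>\<bar> - \<beta> * (t - tc) \<ge> 0" if "t \<le> t2 - \<bar>\<epsilon>\<bar> / \<beta>"
    unfolding shifted_line using that pos by simp
  have ge1: "vc + \<bar>\<epsilon>\<bar> - \<beta> * (t - tc) \<le> 0" if "t \<ge> t2 + \<bar>\<epsilon>\<bar> / \<beta>"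
    unfolding shifted_line using that pos by (simp add: mult_nonneg_nonpos)
  \<comment> \<open>At t = \<open>tc\<close> the two branches agree because the hypothesis on
    \<epsilon> keeps the shifted line nonnegative there.\<close>
  have s: "shift \<epsilon> t = max 0 (vc + \<epsilon> - \<beta> * (t - tc)) - max 0 (vc - \<beta> * (t - tc))"
    using assms mid by (cases "t = tc") (auto simp: shift_def)
  have "\<bar>\<epsilon>\<bar> / \<beta> \<ge> 0" using pos by simp
  consider "t \<le> t2 - \<bar>\<epsilon>\<bar> / \<beta>" | "t2 - \<bar>\<epsilon>\<bar> / \<beta> < t" "t \<le> t2" | "t2 < t" "t \<le> t2 + \<bar>\<epsilon>\<bar> / \<beta>"
    | "t2 + \<bar>\<epsilon>\<bar> / \<beta> < t"
    by linarith
  then show ?thesis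
  proof cases
    case 1
    then have "t \<le> t2" using \<open>\<bar>\<epsilon>\<bar> / \<beta> \<ge> 0\<close> by linarith
    then have "shift \<epsilon> t = \<epsilon>" using le1[OF 1] le2 unfolding s by auto
    then show ?thesis using \<open>t \<le> t2\<close> assms by simp
  next
    case 2
    then show ?thesis using \<open>\<bar>\<epsilon>\<bar> / \<beta> \<ge> 0\<close> le2 assms unfolding s by (auto simp: indicator_def)
  next
    case 3
    then show ?thesis using \<open>\<bar>\<epsilon>\<bar> / \<beta> \<ge> 0\<close> ge2 assms unfolding s by (auto simp: indicator_def)
  next
    case 4
    then have "t \<ge> t2" using \<open>\<bar>\<epsilon>\<bar> / \<beta> \<ge> 0\<close> by linarith
    then have "shift \<epsilon> t = 0" using ge1 4 ge2 unfolding s by auto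
    then show ?thesis using 4 \<open>\<bar>\<epsilon>\<bar> / \<beta> \<ge> 0\<close> by simp
  qed
qed

lemma shift_integrable: "set_integrable lborel {0..} (shift \<epsilon>)"
proof (rule set_integrable_bound)
  show "set_integrable lborel {0..} (\<lambda>t. \<bar>\<epsilon>\<bar> * indicator {t0..t2 + \<bar>\<epsilon>\<bar> / \<beta>} t :: real)"
    unfolding set_integrable_def by (intro integrable_mult_indicator) (simp_all add: integrable_indicator_Icc)
  have "shift \<epsilon> \<in> borel_measurable borel"
    unfolding shift_def[abs_def] by measurable
  then show "set_borel_measurable lborel {0..} (shift \<epsilon>)"
    unfolding set_borel_measurable_def by simp
  show "AE t in lborel. t \<in> {0..} \<longrightarrow> norm (shift \<epsilon> t) \<le> norm (\<bar>\<epsilon>\<bar> * indicator {t0..t2 + \<bar>\<epsilon>\<bar> / \<beta>} t :: real)"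
    using shift_bound by (auto simp: abs_mult)
qed

text \<open>The integral to be compensated is of order \<epsilon>, hence so is the coefficient of
  \<open>bump\<close>.\<close>

lemma shift_integral_bound:
  "\<bar>LINT t:{0..}|lborel. shift \<epsilon> t\<bar> \<le> \<bar>\<epsilon>\<bar> * (t2 + \<bar>\<epsilon>\<bar> / \<beta> - t0)"
proof -
  have "\<bar>LINT t:{0..}|lborel. shift \<epsilon> t\<bar> \<le> (LINT t|lborel. \<bar>indicator {0..} t *\<^sub>R shift \<epsilon> t\<bar>)"
    unfolding set_lebesgue_integral_def by (rule integral_abs_bound)
  also have "\<dots> \<le> (LINT t|lborel. \<bar>\<epsilon>\<bar> * indicator {t0..t2 + \<bar>\<epsilon>\<bar> / \<beta>} t)"
  proof (rule integral_mono)
    show "integrable lborel (\<lambda>t. \<bar>indicator {0..} t *\<^sub>R shift \<epsilon> t\<bar>)"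
      using shift_integrable[of \<epsilon>] unfolding set_integrable_def by (rule integrable_abs)
    show "\<bar>indicator {0..} t *\<^sub>R shift \<epsilon> t\<bar> \<le> \<bar>\<epsilon>\<bar> * indicator {t0..t2 + \<bar>\<epsilon>\<bar> / \<beta>} t" for t
      using shift_bound[of \<epsilon> t] by (auto simp: indicator_def split: if_splits)
  qed (simp add: integrable_indicator_Icc)
  also have "\<dots> = \<bar>\<epsilon>\<bar> * (t2 + \<bar>\<epsilon>\<bar> / \<beta> - t0)"
    using times vc_pos pos by (simp add: t2_def add_increasing2)
  finally show ?thesis .
qed

section \<open>Admissibility of the perturbed profile\<close>

lemma v_slope_EL:
  assumes "t0 \<le> s" "u \<le> tc"
  shows "slope_on (- (lam * b * exp (lam * u))) (- (lam * b * exp (lam * s))) {s..u} v"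
proof (subst slope_on_cong)
  show "v t = A - b * exp (lam * t)" if "t \<in> {s..u}" for t
    using v_EL that assms by auto
  show "slope_on (- (lam * b * exp (lam * u))) (- (lam * b * exp (lam * s))) {s..u} (\<lambda>t. A - b * exp (lam * t))"
    using pos b_pos
    by (intro slope_on_derivative[where g' = "\<lambda>t. - (lam * b * exp (lam * t))"])
       (auto intro!: derivative_eq_intros mult_left_mono)
qed

text \<open>The margin by which the slopes of the curve on \<open>{t0..mid}\<close> may change
  without leaving the range from -\<beta> to 0. At \<open>tc\<close> this margin may be zero, which
  is why the slopes are altered only up to \<open>mid\<close>.\<close>

definition room :: real where
  "room = min (lam * b * exp (lam * t0)) (\<beta> - lam * b * exp (lam * mid))"

lemma room_pos: "room > 0"
proof -
  have "lam * b * exp (lam * mid) < lam * b * exp (lam * tc)"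
    using pos b_pos mid by simp
  also have "\<dots> \<le> \<beta>" by (rule EL_slope_le) simp
  finally show ?thesis
    using pos b_pos by (simp add: room_def)
qed

text \<open>Up to \<open>t0\<close> nothing changes; afterwards the profile has slopes between
  -\<beta> and 0 on each of three pieces. The velocity bounds after \<open>t0\<close> then follow
  from monotonicity, and \<open>balanced\<close> preserves the total integral.\<close>

lemma perturbed_in_trajW:
  assumes \<epsilon>: "\<bar>\<epsilon>\<bar> \<le> vc"
    and small: "\<bar>\<epsilon>\<bar> / (mid - t0) + \<bar>c\<bar> * (mid - t0) \<le> room"
    and balanced: "(LINT t:{0..}|lborel. shift \<epsilon> t) + c * (LINT t:{0..}|lborel. bump t) = 0"
  shows "(\<lambda>t. v t + (shift \<epsilon> t + c * bump t)) \<in> trajW \<alpha> \<beta> vmax v0 d"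
proof -
  let ?w = "\<lambda>t. v t + (shift \<epsilon> t + c * bump t)"
  have before: "?w t = v t" if "t \<le> t0" for t
    using that by (simp add: shift_def bump_def)
  have shifted: "?w t = v t + \<epsilon>" if "t \<in> {mid..tc}" for t
    using that mid by (auto simp: shift_def bump_def)
  have braked: "?w t = max 0 (vc + \<epsilon> - \<beta> * (t - tc))" if "t \<ge> tc" for t
  proof (cases "t = tc")
    case True
    then show ?thesis using shifted[of tc] mid \<epsilon> by (simp add: vc_def)
  next
    case False
    then show ?thesis
      using that mid braking[of t] by (simp add: shift_def bump_def vc_def)
  qed
  \<comment> \<open>The ramp alters slopes by at most \<open>?r\<close> and the parabola by at most
    \<open>?q\<close>; \<open>small\<close> says that together they fit into
    \<open>room\<close>.\<close>
  have first: "slope_on (- \<beta>) 0 {t0..mid} ?w"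
  proof -
    let ?r = "\<bar>\<epsilon>\<bar> / (mid - t0)" and ?q = "\<bar>c\<bar> * (mid - t0)"
    have "slope_on (- ?r) ?r {t0..mid} (shift \<epsilon>)"
    proof (subst slope_on_cong)
      show "shift \<epsilon> t = \<epsilon> * ((t - t0) / (mid - t0))" if "t \<in> {t0..mid}" for t
        using that by (auto simp: shift_def)
      have "?r = \<bar>\<epsilon> / (mid - t0)\<bar>"
        using mid by simp
      then have "- ?r \<le> \<epsilon> / (mid - t0) \<and> \<epsilon> / (mid - t0) \<le> ?r"
        by linarith
      then show "slope_on (- ?r) ?r {t0..mid} (\<lambda>t. \<epsilon> * ((t - t0) / (mid - t0)))"
        using mid by (intro slope_on_derivative[where g' = "\<lambda>_. \<epsilon> / (mid - t0)"])
           (auto intro!: derivative_eq_intros)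
    qed
    moreover have "slope_on (- ?q) ?q {t0..mid} (\<lambda>t. c * bump t)"
    proof (subst slope_on_cong)
      show "c * bump t = c * ((t - t0) * (mid - t))" if "t \<in> {t0..mid}" for t
        using that by (auto simp: bump_def)
      have bound: "- ?q \<le> c * (t0 + mid - 2 * t) \<and> c * (t0 + mid - 2 * t) \<le> ?q"
        if "t0 \<le> t" "t \<le> mid" for t
      proof -
        have "\<bar>c * (t0 + mid - 2 * t)\<bar> \<le> ?q"
          unfolding abs_mult using that by (intro mult_left_mono) auto
        then show ?thesis by linarith
      qed
      show "slope_on (- ?q) ?q {t0..mid} (\<lambda>t. c * ((t - t0) * (mid - t)))"
      proof (rule slope_on_derivative[OF _ bound])
        show "((\<lambda>t. c * ((t - t0) * (mid - t))) has_real_derivative c * (t0 + mid - 2 * t)) (at t)" for t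
          by (auto intro!: derivative_eq_intros simp: algebra_simps)
      qed
    qed
    ultimately have "slope_on (- (lam * b * exp (lam * mid)) + (- ?r + - ?q))
        (- (lam * b * exp (lam * t0)) + (?r + ?q)) {t0..mid} ?w"
      using mid by (intro slope_on_add v_slope_EL) auto
    then show ?thesis
      by (rule slope_on_weaken) (use small in \<open>auto simp: room_def\<close>)
  qed
  have second: "slope_on (- \<beta>) 0 {mid..tc} ?w"
  proof (subst slope_on_cong[OF shifted])
    have "slope_on (- \<beta>) 0 {mid..tc} v"
      using mid EL_slope_le[of tc] pos b_pos by (intro slope_on_weaken[OF v_slope_EL[of mid tc]]) auto
    then show "slope_on (- \<beta>) 0 {mid..tc} (\<lambda>t. v t + \<epsilon>)"
      by (simp add: slope_on_def)
  qed
  have third: "slope_on (- \<beta>) 0 {tc..} ?w"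
  proof (subst slope_on_cong[OF braked])
    show "slope_on (- \<beta>) 0 {tc..} (\<lambda>t. max 0 (vc + \<epsilon> - \<beta> * (t - tc)))"
      unfolding slope_on_def
    proof (intro ballI impI)
      fix s t assume "s \<in> {tc..}" "t \<in> {tc..}" "s \<le> t"
      then have "\<beta> * s \<le> \<beta> * t" using pos by simp
      then show "- \<beta> * (t - s) \<le> max 0 (vc + \<epsilon> - \<beta> * (t - tc)) - max 0 (vc + \<epsilon> - \<beta> * (s - tc)) \<and>
        max 0 (vc + \<epsilon> - \<beta> * (t - tc)) - max 0 (vc + \<epsilon> - \<beta> * (s - tc)) \<le> 0 * (t - s)"
        by (auto simp: algebra_simps max_def)
    qed
  qed simp
  have decreasing: "slope_on (- \<beta>) 0 {t0..} ?w"
  proof -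
    have "slope_on (- \<beta>) 0 ({t0..mid} \<union> {mid..tc}) ?w"
      by (rule slope_on_glue[where c = mid]) (use first second mid in auto)
    then have "slope_on (- \<beta>) 0 (({t0..mid} \<union> {mid..tc}) \<union> {tc..}) ?w"
      by (rule slope_on_glue[where c = tc]) (use third mid in auto)
    also have "({t0..mid} \<union> {mid..tc}) \<union> {tc..} = {t0..}"
      using mid by auto
    finally show ?thesis .
  qed
  have "slope_on (- \<beta>) \<alpha> {0..} ?w"
  proof -
    have "slope_on (- \<beta>) \<alpha> {0..t0} ?w"
    proof (subst slope_on_cong[where g = v])
      have "slope_on (- \<beta>) \<alpha> {0..} v"
        using trajW_D(1)[OF v_W] by (simp add: lipschitz_ab_iff_slope_on)
      then show "slope_on (- \<beta>) \<alpha> {0..t0} v"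
        by (rule slope_on_weaken) auto
    qed (use before in auto)
    moreover have "slope_on (- \<beta>) \<alpha> {t0..} ?w"
      using pos by (intro slope_on_weaken[OF decreasing]) auto
    ultimately have "slope_on (- \<beta>) \<alpha> ({0..t0} \<union> {t0..}) ?w"
      using times by (intro slope_on_glue[where c = t0]) auto
    also have "{0..t0} \<union> {t0..} = {0..}"
      using times by auto
    finally show ?thesis .
  qed
  then have "lipschitz_ab \<alpha> \<beta> ?w"
    by (simp add: lipschitz_ab_iff_slope_on)
  moreover have "0 \<le> ?w t \<and> ?w t \<le> vmax" if "t \<ge> 0" for t
  proof (cases "t \<le> t0")
    case True
    then show ?thesis using before v_bounds(1,2)[OF that] by simp
  next
    case False
    \<comment> \<open>The upper bound is inherited from \<open>t0\<close>, the lower one from the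
      time \<open>max t tc\<close>, where the truncated formula is visibly nonnegative.\<close>
    have "?w t \<le> ?w t0"
      using slope_onD(2)[OF decreasing, of t0 t] False by simp
    also have "\<dots> \<le> vmax"
      using before[of t0] v_bounds(2)[of t0] times by simp
    finally have "?w t \<le> vmax" .
    moreover have "0 \<le> ?w (max t tc)"
      using braked[of "max t tc"] by simp
    moreover have "?w (max t tc) \<le> ?w t"
      using slope_onD(2)[OF decreasing, of t "max t tc"] False times by simp
    ultimately show ?thesis by linarith
  qed
  moreover have "?w 0 = v0"
    using before[of 0] times trajW_D(7)[OF v_W] by simp
  moreover have cb: "set_integrable lborel {0..} (\<lambda>t. c * bump t)"
    by (rule set_integrable_mult_right) (rule bump_integral)
  then have sc: "set_integrable lborel {0..} (\<lambda>t. shift \<epsilon> t + c * bump t)"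
    by (intro set_integral_add shift_integrable)
  then have "set_integrable lborel {0..} ?w"
    by (rule set_integral_add(1)[OF trajW_D(3)[OF v_W]])
  moreover have "(LINT t:{0..}|lborel. ?w t) \<le> d"
    using trajW_D(3,8)[OF v_W] sc cb shift_integrable[of \<epsilon>] balanced
    by (simp only: set_integral_add(2) set_integral_mult_right)
  ultimately show ?thesis
    by (simp add: trajW_def)
qed

text \<open>First variation after adding the multiplier \<open>b\<close> of the constraint on the integral;
  it vanishes on the Euler--Lagrange phase.\<close>
definition \<psi> :: "real \<Rightarrow> real" where
  "\<psi> t = exp (- lam * t) * (v t - A) + b"

section \<open>First variation along the perturbation\<close>

lemma \<psi>_EL: "t \<in> {t0..tc} \<Longrightarrow> \<psi> t = 0"
  using v_EL[of t] by (simp add: \<psi>_def exp_minus field_simps)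

lemma A_pos: "A > 0"
  using pos by (simp add: A_def A_const_def add_pos_pos)

lemma \<psi>_bound:
  assumes "t \<ge> 0"
  shows "\<bar>\<psi> t\<bar> \<le> A + b"
proof -
  have "\<bar>exp (- lam * t) * (v t - A)\<bar> \<le> 1 * A"
    unfolding abs_mult using v_bounds[OF assms] assms pos A_pos by (intro mult_mono) auto
  then show ?thesis
    using b_pos by (simp add: \<psi>_def)
qed

lemma \<psi>_continuous_on: "continuous_on {0..} \<psi>"
  unfolding \<psi>_def[abs_def] by (intro continuous_intros trajW_D(2)[OF v_W])

text \<open>On \<open>{tc..t2}\<close> the truncation is inactive, so \<psi> is the integrand of
  \<open>Fcal_eq_integral\<close>.\<close>

lemma Fcal_eq_\<psi>: "Fcal \<alpha> \<beta> vmax lam vc = lam\<^sup>2 * exp (lam * tc) * (LINT t:{tc..t2}|lborel. \<psi> t)"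
proof -
  have "(LINT t:{tc..t2}|lborel. \<psi> t) =
      (LINT t:{tc..t2}|lborel. exp (- lam * t) * (vc - \<beta> * (t - tc) - A) + (A - vc) * exp (- lam * tc))"
  proof (rule set_lebesgue_integral_cong; (intro allI impI)?)
    fix t assume t: "t \<in> {tc..t2}"
    then have "vc - \<beta> * (t - tc) \<ge> 0"
      using pos by (simp add: t2_def vc_def field_simps)
    then have "v t = vc - \<beta> * (t - tc)"
      using braking[of t] t by (simp add: vc_def)
    then show "\<psi> t = exp (- lam * t) * (vc - \<beta> * (t - tc) - A) + (A - vc) * exp (- lam * tc)"
      unfolding \<psi>_def b_eq[symmetric] by simp
  qed simp
  moreover have "vc \<ge> 0" using vc_pos by (simp add: vc_def)
  ultimately show ?thesis
    using Fcal_eq_integral[OF pos(2,4), of vc \<alpha> vmax tc] by (simp add: t2_def vc_def A_def)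
qed

text \<open>By definition of \<psi> the left side is \<psi> times the perturbation minus b times the
  perturbation. The first product vanishes before \<open>tc\<close>: there is no perturbation before
  \<open>t0\<close>, and \<psi> is 0 on the phase. After \<open>tc\<close>,
  \<open>shift_tail\<close> replaces the shift by \<epsilon>. The term with b integrates to 0 once
  the perturbation is balanced.\<close>

lemma perturbation_variation_le:
  assumes \<epsilon>: "\<bar>\<epsilon>\<bar> \<le> vc" and t: "t \<ge> 0"
  shows "exp (- lam * t) * ((v t - A) * (shift \<epsilon> t + c * bump t)) \<le>
    \<epsilon> * (indicator {tc..t2} t * \<psi> t)
    + (A + b) * \<bar>\<epsilon>\<bar> * indicator {t2 - \<bar>\<epsilon>\<bar> / \<beta>..t2 + \<bar>\<epsilon>\<bar> / \<beta>} t
    - b * (shift \<epsilon> t + c * bump t)"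
proof -
  let ?I = "indicator {tc..t2} t :: real" and ?J = "indicator {t2 - \<bar>\<epsilon>\<bar> / \<beta>..t2 + \<bar>\<epsilon>\<bar> / \<beta>} t :: real"
  have "\<psi> t * (shift \<epsilon> t + c * bump t) \<le> \<epsilon> * (?I * \<psi> t) + (A + b) * \<bar>\<epsilon>\<bar> * ?J"
  proof (cases "t \<ge> tc")
    case True
    then have "bump t = 0" using mid by (simp add: bump_def)
    then have "\<psi> t * (shift \<epsilon> t + c * bump t) = \<epsilon> * (?I * \<psi> t) + \<psi> t * (shift \<epsilon> t - \<epsilon> * ?I)"
      by (simp add: algebra_simps)
    moreover have "\<bar>\<psi> t\<bar> * \<bar>shift \<epsilon> t - \<epsilon> * ?I\<bar> \<le> (A + b) * (\<bar>\<epsilon>\<bar> * ?J)"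
      using \<psi>_bound[OF t] shift_tail[OF True \<epsilon>] A_pos b_pos by (intro mult_mono) auto
    ultimately show ?thesis
      using abs_ge_self[of "\<psi> t * (shift \<epsilon> t - \<epsilon> * ?I)"] by (simp add: abs_mult mult.assoc)
  next
    case False
    have "\<psi> t * (shift \<epsilon> t + c * bump t) = 0"
    proof (cases "t \<ge> t0")
      case True
      then show ?thesis using False \<psi>_EL[of t] by simp
    qed (simp add: shift_def bump_def)
    moreover have "\<epsilon> * (?I * \<psi> t) = 0" "0 \<le> (A + b) * \<bar>\<epsilon>\<bar> * ?J"
      using False A_pos b_pos by simp_all
    ultimately show ?thesis by linarith
  qed
  then show ?thesis
    by (simp add: \<psi>_def algebra_simps)
qed

text \<open>The balanced perturbation is used as competitor in
  \<open>optimal_variational_inequality\<close>. The error window has length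
  \<open>2 * \<bar>\<epsilon>\<bar> / \<beta>\<close>, which makes the error quadratic in
  \<epsilon>.\<close>

lemma variation_lower_bound:
  assumes opt: "optimal_trajectory \<alpha> \<beta> vmax v0 d L (exponential_density lam) v"
  obtains r where "r > 0"
    "\<And>\<epsilon>. \<bar>\<epsilon>\<bar> \<le> r \<Longrightarrow> 0 \<le> \<epsilon> * (LINT t:{tc..t2}|lborel. \<psi> t) + 2 * (A + b) / \<beta> * \<epsilon>\<^sup>2"
proof
  define a where "a = (LINT t:{0..}|lborel. bump t)"
  have a: "a > 0" using bump_integral by (simp add: a_def)
  \<comment> \<open>\<open>C\<close> bounds the coefficient of \<open>bump\<close> per unit of
    \<epsilon> when \<bar>\<epsilon>\<bar> \<le> 1; \<open>D\<close> bounds the resulting change of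
    slope per unit of \<epsilon>, so \<open>r\<close> keeps that change within
    \<open>room\<close>.\<close>
  define C where "C = (t2 + 1 / \<beta> - t0) / a"
  have C: "C > 0"
  proof -
    have "1 / \<beta> > 0" "v tc / \<beta> > 0" using vc_pos pos by simp_all
    then have "t2 + 1 / \<beta> - t0 > 0" using times unfolding t2_def by linarith
    then show ?thesis using a by (simp add: C_def)
  qed
  define D where "D = 1 / (mid - t0) + C * (mid - t0)"
  have D: "D > 0" using mid C by (simp add: D_def add_pos_pos)
  define r where "r = min (min vc 1) (room / D)"
  show "r > 0" using vc_pos room_pos D by (simp add: r_def vc_def)
  fix \<epsilon> assume "\<bar>\<epsilon>\<bar> \<le> r"
  then have \<epsilon>: "\<bar>\<epsilon>\<bar> \<le> vc" "\<bar>\<epsilon>\<bar> \<le> 1" "\<bar>\<epsilon>\<bar> * D \<le> room"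
    using D by (auto simp: r_def pos_le_divide_eq)
  define c where "c = - (LINT t:{0..}|lborel. shift \<epsilon> t) / a"
  have c: "\<bar>c\<bar> \<le> \<bar>\<epsilon>\<bar> * C"
  proof -
    have "\<bar>\<epsilon>\<bar> / \<beta> \<le> 1 / \<beta>" using \<epsilon>(2) pos by (simp add: divide_right_mono)
    then have "\<bar>\<epsilon>\<bar> * (t2 + \<bar>\<epsilon>\<bar> / \<beta> - t0) \<le> \<bar>\<epsilon>\<bar> * (t2 + 1 / \<beta> - t0)"
      by (intro mult_left_mono) auto
    then have "\<bar>LINT t:{0..}|lborel. shift \<epsilon> t\<bar> \<le> \<bar>\<epsilon>\<bar> * (t2 + 1 / \<beta> - t0)"
      using shift_integral_bound[of \<epsilon>] by linarith
    then show ?thesis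
      using a by (simp add: c_def C_def abs_divide divide_right_mono)
  qed
  have "\<bar>c\<bar> * (mid - t0) \<le> \<bar>\<epsilon>\<bar> * C * (mid - t0)"
    using c mid by (intro mult_right_mono) auto
  then have small: "\<bar>\<epsilon>\<bar> / (mid - t0) + \<bar>c\<bar> * (mid - t0) \<le> room"
    using \<epsilon>(3) by (simp add: D_def algebra_simps)
  have balanced: "(LINT t:{0..}|lborel. shift \<epsilon> t) + c * (LINT t:{0..}|lborel. bump t) = 0"
    using a by (simp add: c_def a_def)
  define \<delta> where "\<delta> t = shift \<epsilon> t + c * bump t" for t
  have w: "(\<lambda>t. v t + \<delta> t) \<in> trajW \<alpha> \<beta> vmax v0 d"
    unfolding \<delta>_def by (rule perturbed_in_trajW[OF \<epsilon>(1) small balanced])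
  have cb: "set_integrable lborel {0..} (\<lambda>t. c * bump t)"
    by (rule set_integrable_mult_right) (rule bump_integral)
  have \<delta>_int: "set_integrable lborel {0..} \<delta>"
    unfolding \<delta>_def[abs_def] by (intro set_integral_add shift_integrable cb)
  have \<delta>0: "(LINT t:{0..}|lborel. \<delta> t) = 0"
    unfolding \<delta>_def using balanced cb shift_integrable[of \<epsilon>]
    by (simp only: set_integral_add(2) set_integral_mult_right)
  let ?J = "{t2 - \<bar>\<epsilon>\<bar> / \<beta>..t2 + \<bar>\<epsilon>\<bar> / \<beta>}"
  have eq1: "indicator {0..} t *\<^sub>R (indicator {tc..t2} t * \<psi> t) = indicator {tc..t2} t *\<^sub>R \<psi> t" for t
    using times by (auto simp: indicator_def)
  have i1: "set_integrable lborel {0..} (\<lambda>t. indicator {tc..t2} t * \<psi> t)"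
    unfolding set_integrable_def eq1 unfolding set_integrable_def[symmetric]
    using times by (intro borel_integrable_atLeastAtMost' continuous_on_subset[OF \<psi>_continuous_on]) auto
  have I1: "(LINT t:{0..}|lborel. indicator {tc..t2} t * \<psi> t) = (LINT t:{tc..t2}|lborel. \<psi> t)"
    unfolding set_lebesgue_integral_def eq1 ..
  \<comment> \<open>The window thus lies in the half-line of nonnegative times and keeps its full
    length there.\<close>
  have "t2 - \<bar>\<epsilon>\<bar> / \<beta> \<ge> tc"
    using \<epsilon>(1) pos by (simp add: t2_def vc_def divide_right_mono)
  then have eq2: "indicator {0..} t *\<^sub>R indicator ?J t = (indicator ?J t :: real)" for t
    using times by (auto simp: indicator_def)
  have i2: "set_integrable lborel {0..} (\<lambda>t. indicator ?J t :: real)"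
    unfolding set_integrable_def eq2 by (rule integrable_indicator_Icc)
  have I2: "(LINT t:{0..}|lborel. indicator ?J t :: real) = 2 * \<bar>\<epsilon>\<bar> / \<beta>"
    unfolding set_lebesgue_integral_def eq2 using pos by simp
  let ?rhs = "\<lambda>t. \<epsilon> * (indicator {tc..t2} t * \<psi> t) + (A + b) * \<bar>\<epsilon>\<bar> * indicator ?J t - b * \<delta> t"
  note i1' = set_integrable_mult_right[of \<epsilon>, OF i1]
    and i2' = set_integrable_mult_right[of "(A + b) * \<bar>\<epsilon>\<bar>", OF i2]
    and i3' = set_integrable_mult_right[of b, OF \<delta>_int]
  have i4': "set_integrable lborel {0..}
      (\<lambda>t. \<epsilon> * (indicator {tc..t2} t * \<psi> t) + (A + b) * \<bar>\<epsilon>\<bar> * indicator ?J t)"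
    using i1' i2' by (rule set_integral_add)
  have "0 \<le> (LINT t:{0..}|lborel. exp (- lam * t) * ((v t - A) * \<delta> t))"
    using optimal_variational_inequality[OF pos(1,3,4) opt w] by (simp add: A_def)
  also have "\<dots> \<le> (LINT t:{0..}|lborel. ?rhs t)"
  proof (rule set_integral_mono)
    show "exp (- lam * t) * ((v t - A) * \<delta> t) \<le> ?rhs t" if "t \<in> {0..}" for t
      unfolding \<delta>_def using that by (intro perturbation_variation_le[OF \<epsilon>(1)]) auto
    show "set_integrable lborel {0..} ?rhs"
      using i4' i3' by (rule set_integral_diff)
    show "set_integrable lborel {0..} (\<lambda>t. exp (- lam * t) * ((v t - A) * \<delta> t))"
    proof (rule set_integrable_exp_weighted[OF pos(4)])
      \<comment> \<open>Continuity of \<delta> comes from writing it as the difference of two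
        trajectories, which avoids its piecewise formula; the bound by \<open>vmax\<close> below has
        the same source.\<close>
      have "continuous_on {0..} (\<lambda>t. (v t - A) * ((v t + \<delta> t) - v t))"
        by (intro continuous_intros trajW_D(2)[OF v_W] trajW_D(2)[OF w])
      then show "continuous_on {0..} (\<lambda>t. (v t - A) * \<delta> t)" by simp
      show "\<bar>(v t - A) * \<delta> t\<bar> \<le> A * vmax" if "t \<ge> 0" for t
        unfolding abs_mult using v_bounds[OF that] trajW_D(4,5)[OF w that] A_pos
        by (intro mult_mono) auto
    qed
  qed
  also have "\<dots> = \<epsilon> * (LINT t:{tc..t2}|lborel. \<psi> t) + (A + b) * \<bar>\<epsilon>\<bar> * (2 * \<bar>\<epsilon>\<bar> / \<beta>)"
    using set_integral_diff(2)[OF i4' i3'] set_integral_add(2)[OF i1' i2']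
    by (simp only: set_integral_mult_right I1 I2 \<delta>0 mult_zero_right diff_zero)
  also have "(A + b) * \<bar>\<epsilon>\<bar> * (2 * \<bar>\<epsilon>\<bar> / \<beta>) = 2 * (A + b) / \<beta> * \<bar>\<epsilon>\<bar>\<^sup>2"
    by (simp only: power2_eq_square times_divide_eq_right times_divide_eq_left mult_ac)
  finally show "0 \<le> \<epsilon> * (LINT t:{tc..t2}|lborel. \<psi> t) + 2 * (A + b) / \<beta> * \<epsilon>\<^sup>2"
    by simp
qed

text \<open>The lower bound holds for both signs of \<epsilon> and equals 0 at \<epsilon> = 0, so it
  has a local minimum there and its derivative \<open>K\<close> vanishes.\<close>

lemma Fcal_switch_eq_0:
  assumes opt: "optimal_trajectory \<alpha> \<beta> vmax v0 d L (exponential_density lam) v"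
  shows "Fcal \<alpha> \<beta> vmax lam vc = 0"
proof -
  define K where "K = (LINT t:{tc..t2}|lborel. \<psi> t)"
  define M where "M = 2 * (A + b) / \<beta>"
  obtain r where r: "r > 0" "\<And>\<epsilon>. \<bar>\<epsilon>\<bar> \<le> r \<Longrightarrow> 0 \<le> \<epsilon> * K + M * \<epsilon>\<^sup>2"
    using variation_lower_bound[OF opt] unfolding K_def M_def by blast
  have "((\<lambda>\<epsilon>. \<epsilon> * K + M * \<epsilon>\<^sup>2) has_real_derivative K) (at 0)"
    by (auto intro!: derivative_eq_intros)
  then have "K = 0"
    by (rule DERIV_local_min[OF _ r(1)]) (use r(2) in auto)
  then show ?thesis
    by (simp add: Fcal_eq_\<psi> K_def)
qed

end

section \<open>The switching velocity as the unique zero\<close>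

theorem theorem6p1:
  fixes \<alpha> \<beta> vmax lam v0 d L tc :: real and v :: "real \<Rightarrow> real"
  assumes "\<alpha> > 0" and "\<beta> > 0" and "vmax > 0" and "lam > 0"
    and "0 \<le> v0" and "v0 \<le> vmax"
    and "d > 0" and "d \<ge> v0\<^sup>2 / (2 * \<beta>)"
    and "L \<ge> vmax\<^sup>2 / (2 * \<alpha>)"
    and "v_beta \<alpha> \<beta> vmax lam > 0"
    and "optimal_trajectory \<alpha> \<beta> vmax v0 d L (exponential_density lam) v"
    and "ends_in_EL_beta \<alpha> \<beta> vmax lam v tc"
  shows "v_beta \<alpha> \<beta> vmax lam \<le> v tc \<and> v tc < vmax \<and> Fcal \<alpha> \<beta> vmax lam (v tc) = 0 \<and>
    (\<forall>vc. v_beta \<alpha> \<beta> vmax lam \<le> vc \<and> vc < vmax \<and> Fcal \<alpha> \<beta> vmax lam vc = 0 \<longrightarrow> vc = v tc)"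
proof -
  obtain t0 t2 b where EL: "0 \<le> t0" "t0 < tc" "\<And>t. t \<in> {t0..tc} \<Longrightarrow> v t = EL_curve \<alpha> vmax lam b t"
    and brake: "tc < t2" "\<And>t. t \<in> {tc..t2} \<Longrightarrow> v t = v tc - \<beta> * (t - tc)"
    and stop: "\<And>t. t \<ge> t2 \<Longrightarrow> v t = 0"
    using assms(12) by (auto simp: ends_in_EL_beta_def EL_phase_def beta_phase_def)
  \<comment> \<open>Comparing both descriptions of \<open>v\<close> at the stopping time gives
    \<open>v tc > 0\<close> and identifies that time with
    \<open>tc + v tc / \<beta>\<close>.\<close>
  have vtc: "v tc = \<beta> * (t2 - tc)"
    using brake(2)[of t2] stop[of t2] brake(1) by simp
  interpret EL_beta_trajectory \<alpha> \<beta> vmax lam v0 d t0 tc b "A_const \<alpha> vmax lam" "v tc" "tc + v tc / \<beta>" v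
  proof unfold_locales
    show "v \<in> trajV \<alpha> \<beta> vmax v0 d"
      using assms(11) by (simp add: optimal_trajectory_def)
    show "v tc > 0"
      using vtc brake(1) assms(2) by simp
    show "v t = max 0 (v tc - \<beta> * (t - tc))" if "t \<ge> tc" for t
    proof -
      have eq: "v tc - \<beta> * (t - tc) = \<beta> * (t2 - t)"
        by (simp add: vtc algebra_simps)
      show ?thesis
      proof (cases "t \<le> t2")
        case True
        then show ?thesis using brake(2)[of t] that assms(2) unfolding eq by simp
      next
        case False
        then have "\<beta> * (t2 - t) \<le> 0" using assms(2) by (simp add: mult_nonneg_nonpos)
        then show ?thesis using stop[of t] False unfolding eq by simp
      qed
    qed
  qed (use assms EL in auto)
  have F: "Fcal \<alpha> \<beta> vmax lam (v tc) = 0"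
    by (rule Fcal_switch_eq_0[OF assms(11)])
  \<comment> \<open>Since \<open>v_beta\<close> is positive, every candidate is positive, which
    rules out the trivial zero 0 of \<open>Fcal\<close>.\<close>
  then show ?thesis
    using v_beta_le vc_less_vmax Fcal_at_most_one_positive_zero[OF assms(1-4)] assms(10) vc_pos
    by (metis order_less_le_trans)
qed

end
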